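(* Let $n\ge 1$ and $1\le i\le n$. For $\pi\in\mathcal S_n(321)$ let $\ell_i(\pi)=\chi_{\pi^{-1}(i)\le i}+\chi_{\pi(i)>i}$. Then the statistic $\ell_i$ is $1$-mesic under the action of rowmotion $\rho_{\mathcal S}$ on $\mathcal S_n(321)$; that is, for every orbit $\mathcal O$ of $\rho_{\mathcal S}$ on $\mathcal S_n(321)$, $\frac{1}{|\mathcal O|}\sum_{\pi\in\mathcal O}\ell_i(\pi)=1$.
   Context: $\chi_B$ equals $1$ if the statement $B$ is true and $0$ otherwise. $\mathcal S_n(321)$ is the set of permutations $\pi$ of $\{1,\dots,n\}$ that are $321$-avoiding: there are no $i<j<k$ with $\pi(i)>\pi(j)>\pi(k)$. $\mathbf A^{n-1}$ is the poset of intervals $\{[i,j]:1\le i\le j\le n-1\}$ ordered by inclusion (type $A$ positive root poset), and $\mathcal A(\mathbf A^{n-1})$ is its set of antichains. Antichain rowmotion $\rho_{\mathcal A}:\mathcal A(\mathbf A^{n-1})\to\mathcal A(\mathbf A^{n-1})$ sends an antichain $A$ to the set of minimal elements of the complement of the order ideal $\{x: x\le y\text{ for some }y\in A\}$ generated by $A$; it is a bijection. The map $\mathrm{Exc}:\mathcal S_n(321)\to\mathcal A(\mathbf A^{n-1})$, $\mathrm{Exc}(\pi)=\{[i,\pi(i)-1]:\pi(i)>i\}$, is a bijection. Rowmotion on $321$-avoiding permutations is $\rho_{\mathcal S}=\mathrm{Exc}^{-1}\circ\rho_{\mathcal A}\circ\mathrm{Exc}$. *)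

theory Defs
  imports Complex_Main "HOL-Combinatorics.Combinatorics"
begin

definition S321 :: "nat \<Rightarrow> (nat \<Rightarrow> nat) set" where
  "S321 n = {\<pi>. \<pi> permutes {1..n} \<and>
     \<not> (\<exists>i\<in>{1..n}. \<exists>j\<in>{1..n}. \<exists>k\<in>{1..n}. i < j \<and> j < k \<and> \<pi> i > \<pi> j \<and> \<pi> j > \<pi> k)}"

text \<open>The type A positive root poset, ordered by inclusion. With argument \<open>m\<close> its elements are
  the nonempty intervals \<open>{i..j}\<close> with \<open>1 \<le> i \<le> j \<le> m\<close>, so \<open>root_poset (n - 1)\<close> is the poset
  attached to permutations of \<open>{1..n}\<close>.\<close>

definition root_poset :: "nat \<Rightarrow> nat set set" where
  "root_poset m = {{i..j} | i j. 1 \<le> i \<and> i \<le> j \<and> j \<le> m}"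

text \<open>The next four definitions concern an arbitrary family \<open>P\<close> of sets, viewed as a poset
  under \<open>\<subseteq>\<close>.\<close>

definition antichains :: "'a set set \<Rightarrow> 'a set set set" where
  "antichains P = {A. A \<subseteq> P \<and> (\<forall>x\<in>A. \<forall>y\<in>A. x \<subseteq> y \<longrightarrow> x = y)}"

definition order_ideal :: "'a set set \<Rightarrow> 'a set set \<Rightarrow> 'a set set" where
  "order_ideal P A = {x \<in> P. \<exists>y\<in>A. x \<subseteq> y}"

definition minimal_elements :: "'a set set \<Rightarrow> 'a set set" where
  "minimal_elements X = {x \<in> X. \<forall>y\<in>X. y \<subseteq> x \<longrightarrow> y = x}"

definition antichain_rowmotion :: "'a set set \<Rightarrow> 'a set set \<Rightarrow> 'a set set" where
  "antichain_rowmotion P A = minimal_elements (P - order_ideal P A)"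

definition Exc :: "nat \<Rightarrow> (nat \<Rightarrow> nat) \<Rightarrow> nat set set" where
  "Exc n \<pi> = {{i..\<pi> i - 1} | i. i \<in> {1..n} \<and> \<pi> i > i}"

text \<open>\<open>Exc n\<close> maps \<open>S321 n\<close> bijectively onto \<open>antichains (root_poset (n - 1))\<close>; its inverse is
  taken relative to \<open>S321 n\<close>. Only the values on \<open>S321 n\<close> are meaningful.\<close>

definition rowmotion_S :: "nat \<Rightarrow> (nat \<Rightarrow> nat) \<Rightarrow> (nat \<Rightarrow> nat)" where
  "rowmotion_S n \<pi> =
     inv_into (S321 n) (Exc n) (antichain_rowmotion (root_poset (n - 1)) (Exc n \<pi>))"

definition ell :: "nat \<Rightarrow> (nat \<Rightarrow> nat) \<Rightarrow> nat" where
  "ell i \<pi> = of_bool (inv \<pi> i \<le> i) + of_bool (\<pi> i > i)"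

text \<open>\<open>c\<close>-mesy of a statistic on \<open>S\<close> under a bijection \<open>f\<close> of the finite set \<open>S\<close>. The library's
  \<open>orbit f x\<close> consists of the \<open>(f ^^ k) x\<close> with \<open>k > 0\<close>, which for such \<open>f\<close> and \<open>x \<in> S\<close> is the
  full orbit of \<open>x\<close>.\<close>

definition mesic :: "real \<Rightarrow> ('a \<Rightarrow> nat) \<Rightarrow> ('a \<Rightarrow> 'a) \<Rightarrow> 'a set \<Rightarrow> bool" where
  "mesic c st f S \<longleftrightarrow>
     (\<forall>\<O> \<in> orbit f ` S. 1 / real (card \<O>) * (\<Sum>x\<in>\<O>. real (st x)) = c)"

end

theory Submission
  imports Defs "HOL-Library.Infinite_Set"
begin

text \<open>
  Let \<open>L A\<close> and \<open>R A\<close> denote the sets of left and right end points of the intervals of an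
  antichain \<open>A\<close>. A point \<open>i\<close> is fixed by the permutation belonging to \<open>A\<close> iff no interval of \<open>A\<close>
  contains \<open>i\<close> or \<open>i - 1\<close>. For \<open>1 \<le> i < n\<close>, the minimal elements of the complement of the ideal
  of \<open>A\<close> satisfy \<open>i \<in> L (\<rho> A)\<close> iff \<open>i + 1 \<in> L A\<close> or \<open>i + 1\<close> is fixed, and \<open>i \<in> R (\<rho> A)\<close> iff
  \<open>i - 1 \<in> R A\<close> or \<open>i\<close> is fixed, the alternatives being exclusive. Hence
  \<open>ell (i + 1) = [i \<in> R A] + [i \<in> L (\<rho> A)]\<close> and \<open>ell i = [i \<in> L A] + [i \<in> R (\<rho> A)]\<close>, so the
  sums of \<open>ell i\<close> and \<open>ell (i + 1)\<close> over an orbit agree, and \<open>ell 1\<close> is identically \<open>1\<close>.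
\<close>

section \<open>Rowmotion on antichains\<close>

text \<open>Intervals are plain sets; the guard keeps them nonempty, so that the set determines its
  end points.\<close>

definition left_ends :: "nat set set \<Rightarrow> nat set" where
  "left_ends A = {a. \<exists>b\<ge>a. {a..b} \<in> A}"

definition right_ends :: "nat set set \<Rightarrow> nat set" where
  "right_ends A = {b. \<exists>a\<le>b. {a..b} \<in> A}"

lemma finite_root_poset: "finite (root_poset m)"
  by (rule finite_subset[of _ "Pow {1..m}"]) (auto simp: root_poset_def)

lemma interval_in_root_poset_iff:
  assumes "a \<le> b"
  shows "{a..b} \<in> root_poset m \<longleftrightarrow> 1 \<le> a \<and> b \<le> m"
  using assms unfolding root_poset_def by (auto simp: Icc_eq_Icc)

lemma root_posetE:
  assumes "x \<in> root_poset m"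
  obtains a b where "x = {a..b}" "1 \<le> a" "a \<le> b" "b \<le> m"
  using assms unfolding root_poset_def by auto

lemma antichainsD: "A \<in> antichains P \<Longrightarrow> x \<in> A \<Longrightarrow> y \<in> A \<Longrightarrow> x \<subseteq> y \<Longrightarrow> x = y"
  by (auto simp: antichains_def)

lemma antichains_subset: "A \<in> antichains P \<Longrightarrow> A \<subseteq> P"
  by (auto simp: antichains_def)

lemma interval_antichainE:
  assumes "A \<in> antichains (root_poset m)" "x \<in> A"
  obtains a b where "x = {a..b}" "1 \<le> a" "a \<le> b" "b \<le> m"
  using root_posetE[OF subsetD[OF antichains_subset[OF assms(1)] assms(2)]] by blast

lemma antichain_rowmotion_in_antichains: "antichain_rowmotion P A \<in> antichains P"
  by (auto simp: antichain_rowmotion_def antichains_def minimal_elements_def)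

section \<open>Injectivity of rowmotion, and the end points of its values\<close>

lemma minimal_element_below:
  assumes "finite X" "x \<in> X"
  obtains y where "y \<in> minimal_elements X" "y \<subseteq> x"
  using finite_has_minimal2[OF assms] unfolding minimal_elements_def by blast

text \<open>The antichain is recovered as the set of maximal elements of its ideal: passing from
  \<open>A\<close> to \<open>B\<close> and back gives \<open>x \<subseteq> y \<subseteq> z\<close>
  with \<open>x\<close> and \<open>z\<close> in \<open>A\<close>, so all three coincide.\<close>

lemma order_ideal_antichain_inj: "inj_on (order_ideal P) (antichains P)"
proof -
  have *: "A \<subseteq> B" if A: "A \<in> antichains P" and B: "B \<in> antichains P"
    and eq: "order_ideal P A = order_ideal P B" for A B
  proof
    fix x assume x: "x \<in> A"
    then have "x \<in> order_ideal P A" using A by (auto simp: order_ideal_def antichains_def)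
    then have "x \<in> order_ideal P B" using eq by simp
    then obtain y where y: "y \<in> B" "x \<subseteq> y" by (auto simp: order_ideal_def)
    then have "y \<in> order_ideal P B" using B by (auto simp: order_ideal_def antichains_def)
    then have "y \<in> order_ideal P A" using eq by simp
    then obtain z where z: "z \<in> A" "y \<subseteq> z" by (auto simp: order_ideal_def)
    have "x = z" using antichainsD[OF A x z(1)] y z by blast
    then show "x \<in> B" using y z by auto
  qed
  show ?thesis by (rule inj_onI) (use * in blast)
qed

text \<open>In a finite poset the minimal elements generate the complement of the ideal as an
  up-set. So they determine the complement, then the ideal, then the antichain.\<close>

lemma antichain_rowmotion_inj:
  assumes "finite P"
  shows "inj_on (antichain_rowmotion P) (antichains P)"
proof (rule inj_onI)
  have *: "P - order_ideal P A \<subseteq> P - order_ideal P B"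
    if eq: "antichain_rowmotion P A = antichain_rowmotion P B" for A B
  proof
    fix x assume x: "x \<in> P - order_ideal P A"
    obtain y where y: "y \<in> minimal_elements (P - order_ideal P A)" "y \<subseteq> x"
      using minimal_element_below[OF _ x] assms by auto
    then have "y \<in> P - order_ideal P B"
      using eq by (auto simp: antichain_rowmotion_def minimal_elements_def)
    then show "x \<in> P - order_ideal P B" using x y unfolding order_ideal_def by blast
  qed
  fix A B assume AB: "A \<in> antichains P" "B \<in> antichains P"
    and eq: "antichain_rowmotion P A = antichain_rowmotion P B"
  have "P - order_ideal P A = P - order_ideal P B" using *[OF eq] *[OF eq[symmetric]] by blast
  moreover have "order_ideal P A \<subseteq> P" "order_ideal P B \<subseteq> P" by (auto simp: order_ideal_def)
  ultimately have "order_ideal P A = order_ideal P B" by blast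
  then show "A = B" using order_ideal_antichain_inj AB by (meson inj_onD)
qed

text \<open>Lying in the ideal is inherited downwards, so minimality need only be tested on the
  lower covers \<open>{Suc a..b}\<close> and \<open>{a..b-1}\<close>. A singleton has none, whence
  the guard \<open>a < b\<close>.\<close>

lemma interval_in_rowmotion_iff:
  assumes ab: "a \<le> b"
  shows "{a..b} \<in> antichain_rowmotion (root_poset m) A \<longleftrightarrow>
    1 \<le> a \<and> b \<le> m \<and> \<not> (\<exists>y\<in>A. {a..b} \<subseteq> y) \<and>
    (a < b \<longrightarrow> (\<exists>y\<in>A. {Suc a..b} \<subseteq> y) \<and> (\<exists>y\<in>A. {a..b-1} \<subseteq> y))" (is "?l \<longleftrightarrow> ?r")
proof
  assume ?l
  then have min: "{a..b} \<in> root_poset m" "\<not> (\<exists>y\<in>A. {a..b} \<subseteq> y)"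
    and below: "\<And>x. x \<in> root_poset m \<Longrightarrow> x \<subset> {a..b} \<Longrightarrow> \<exists>y\<in>A. x \<subseteq> y"
    unfolding antichain_rowmotion_def minimal_elements_def order_ideal_def by auto
  have P: "1 \<le> a" "b \<le> m" using min(1) interval_in_root_poset_iff[OF ab] by auto
  have "(\<exists>y\<in>A. {Suc a..b} \<subseteq> y) \<and> (\<exists>y\<in>A. {a..b-1} \<subseteq> y)" if "a < b"
  proof
    show "\<exists>y\<in>A. {Suc a..b} \<subseteq> y"
    proof (rule below)
      show "{Suc a..b} \<in> root_poset m" using that P by (subst interval_in_root_poset_iff) auto
    qed (use that in auto)
    show "\<exists>y\<in>A. {a..b-1} \<subseteq> y"
    proof (rule below)
      show "{a..b-1} \<in> root_poset m" using that P by (subst interval_in_root_poset_iff) auto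
      have "b \<in> {a..b}" "b \<notin> {a..b-1}" using that by auto
      then show "{a..b-1} \<subset> {a..b}" by auto
    qed
  qed
  then show ?r using P min by blast
next
  assume r: ?r
  have "y = {a..b}" if y: "y \<in> root_poset m - order_ideal (root_poset m) A" "y \<subseteq> {a..b}" for y
  proof (rule ccontr)
    assume ne: "y \<noteq> {a..b}"
    obtain c d where cd: "y = {c..d}" "1 \<le> c" "c \<le> d" "d \<le> m"
      using y by (auto elim: root_posetE)
    have le: "a \<le> c" "d \<le> b" using y(2) cd by auto
    have "a < c \<or> d < b" using le ne cd by (auto simp: Icc_eq_Icc)
    then have "a < b" and "y \<subseteq> {Suc a..b} \<or> y \<subseteq> {a..b-1}" using le cd by auto
    then have "\<exists>z\<in>A. y \<subseteq> z" using r by (meson subset_trans)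
    then show False using y by (auto simp: order_ideal_def)
  qed
  moreover have "{a..b} \<in> root_poset m - order_ideal (root_poset m) A"
    using r ab by (auto simp: interval_in_root_poset_iff order_ideal_def)
  ultimately show ?l unfolding antichain_rowmotion_def minimal_elements_def by auto
qed

lemma left_ends_rowmotion:
  assumes A: "A \<in> antichains (root_poset m)" and i: "1 \<le> i" "i \<le> m"
  shows "i \<in> left_ends (antichain_rowmotion (root_poset m) A) \<longleftrightarrow>
    Suc i \<in> left_ends A \<or> i \<notin> \<Union>A \<and> Suc i \<notin> \<Union>A"
proof (intro iffI)
  assume "i \<in> left_ends (antichain_rowmotion (root_poset m) A)"
  then obtain b where b: "i \<le> b" "{i..b} \<in> antichain_rowmotion (root_poset m) A"
    by (auto simp: left_ends_def)
  note min = iffD1[OF interval_in_rowmotion_iff[OF b(1)] b(2)]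
  \<comment> \<open>Such a \<open>y\<close> must omit \<open>i\<close>, or it would cover
    \<open>{i..b}\<close>; so it starts at \<open>Suc i\<close>. The last premise serves the case
    \<open>b = i\<close>, where \<open>{Suc i..b}\<close> is empty.\<close>
  have left: "Suc i \<in> left_ends A" if y: "y \<in> A" "{Suc i..b} \<subseteq> y" "Suc i \<in> y" for y
  proof -
    obtain c d where cd: "y = {c..d}" "c \<le> d" using interval_antichainE[OF A y(1)] by metis
    have "\<not> {i..b} \<subseteq> y" using min y by blast
    moreover have "{i..b} = insert i {Suc i..b}" using b by auto
    ultimately have "i \<notin> y" using y by auto
    then have "c = Suc i" using y cd by auto
    then show ?thesis using cd y by (auto simp: left_ends_def)
  qed
  show "Suc i \<in> left_ends A \<or> i \<notin> \<Union>A \<and> Suc i \<notin> \<Union>A"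
  proof (cases "i < b")
    case True
    then obtain y where "y \<in> A" "{Suc i..b} \<subseteq> y" using min by blast
    moreover from this have "Suc i \<in> y" using True by auto
    ultimately show ?thesis using left by blast
  next
    case False
    then have "b = i" using b by simp
    then show ?thesis using min left by auto
  qed
next
  assume r: "Suc i \<in> left_ends A \<or> i \<notin> \<Union>A \<and> Suc i \<notin> \<Union>A"
  show "i \<in> left_ends (antichain_rowmotion (root_poset m) A)"
  proof (cases "i \<in> \<Union>A")
    case False
    then have "{i..i} \<in> antichain_rowmotion (root_poset m) A"
      using i by (subst interval_in_rowmotion_iff) auto
    then show ?thesis by (auto simp: left_ends_def)
  next
    case iA: True
    then obtain b where b: "Suc i \<le> b" "{Suc i..b} \<in> A" using r by (auto simp: left_ends_def)
    \<comment> \<open>\<open>Q y\<close> puts \<open>{i..y}\<close> outside the ideal. It holds at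
      \<open>b\<close>, since \<open>{i..b}\<close> properly contains a member of \<open>A\<close>,
      and fails at \<open>i\<close>. For the least such \<open>y\<close>, one lower cover is in the
      ideal by leastness, the other because it lies in \<open>{Suc i..b}\<close>.\<close>
    define Q where "Q y \<longleftrightarrow> i \<le> y \<and> \<not> (\<exists>z\<in>A. {i..y} \<subseteq> z)" for y
    have Qb: "Q b"
    proof -
      have False if "z \<in> A" "{i..b} \<subseteq> z" for z
      proof -
        have "{Suc i..b} = z" by (rule antichainsD[OF A b(2) that(1)]) (use that in auto)
        then show False using that b by auto
      qed
      then show ?thesis unfolding Q_def using b by auto
    qed
    define y where "y = (LEAST y. Q y)"
    have Qy: "Q y" unfolding y_def using Qb by (rule LeastI)
    have yb: "y \<le> b" unfolding y_def using Qb by (rule Least_le)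
    have "\<not> Q i" using iA by (auto simp: Q_def)
    then have iy: "i < y" using Qy by (auto simp: Q_def le_eq_less_or_eq)
    have "\<not> Q (y - 1)" using iy not_less_Least[of "y-1" Q] unfolding y_def by auto
    moreover have "b \<le> m" using b antichains_subset[OF A] interval_in_root_poset_iff by blast
    moreover have "\<exists>z\<in>A. {Suc i..y} \<subseteq> z" using yb b(2) by (intro bexI[of _ "{Suc i..b}"]) auto
    ultimately have "{i..y} \<in> antichain_rowmotion (root_poset m) A"
      using i iy yb Qy b by (subst interval_in_rowmotion_iff) (auto simp: Q_def)
    then show ?thesis using iy by (auto simp: left_ends_def intro!: exI[of _ y])
  qed
qed

text \<open>Mirror image of \<open>left_ends_rowmotion\<close>. For \<open>i = 1\<close> the point
  \<open>i - 1\<close> is \<open>0\<close>, which lies in no interval of the poset.\<close>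

lemma right_ends_rowmotion:
  assumes A: "A \<in> antichains (root_poset m)" and i: "1 \<le> i" "i \<le> m"
  shows "i \<in> right_ends (antichain_rowmotion (root_poset m) A) \<longleftrightarrow>
    i - 1 \<in> right_ends A \<or> i \<notin> \<Union>A \<and> i - 1 \<notin> \<Union>A"
proof (intro iffI)
  assume "i \<in> right_ends (antichain_rowmotion (root_poset m) A)"
  then obtain a where a: "a \<le> i" "{a..i} \<in> antichain_rowmotion (root_poset m) A"
    by (auto simp: right_ends_def)
  note min = iffD1[OF interval_in_rowmotion_iff[OF a(1)] a(2)]
  have right: "i - 1 \<in> right_ends A" if y: "y \<in> A" "{a..i-1} \<subseteq> y" "i - 1 \<in> y" for y
  proof -
    obtain c d where cd: "y = {c..d}" "c \<le> d" using interval_antichainE[OF A y(1)] by metis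
    have "\<not> {a..i} \<subseteq> y" using min y by blast
    moreover have "{a..i} = insert i {a..i-1}" using a i by auto
    ultimately have "i \<notin> y" using y by auto
    then have "d = i - 1" using y cd by auto
    then show ?thesis using cd y by (auto simp: right_ends_def)
  qed
  show "i - 1 \<in> right_ends A \<or> i \<notin> \<Union>A \<and> i - 1 \<notin> \<Union>A"
  proof (cases "a < i")
    case True
    then obtain y where "y \<in> A" "{a..i-1} \<subseteq> y" using min by blast
    moreover from this have "i - 1 \<in> y" using True by auto
    ultimately show ?thesis using right by blast
  next
    case False
    then have "a = i" using a by simp
    then show ?thesis using min right i by auto
  qed
next
  assume r: "i - 1 \<in> right_ends A \<or> i \<notin> \<Union>A \<and> i - 1 \<notin> \<Union>A"
  show "i \<in> right_ends (antichain_rowmotion (root_poset m) A)"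
  proof (cases "i \<in> \<Union>A")
    case False
    then have "{i..i} \<in> antichain_rowmotion (root_poset m) A"
      using i by (subst interval_in_rowmotion_iff) auto
    then show ?thesis by (auto simp: right_ends_def)
  next
    case iA: True
    then obtain a where a: "a \<le> i - 1" "{a..i-1} \<in> A" using r by (auto simp: right_ends_def)
    define Q where "Q x \<longleftrightarrow> x \<le> i \<and> \<not> (\<exists>z\<in>A. {x..i} \<subseteq> z)" for x
    have a1: "1 \<le> a" using a antichains_subset[OF A] interval_in_root_poset_iff by blast
    have Qa: "Q a"
    proof -
      have False if "z \<in> A" "{a..i} \<subseteq> z" for z
      proof -
        have "{a..i-1} \<subseteq> {a..i}" by auto
        then have "{a..i-1} = z" using antichainsD[OF A a(2) that(1)] that(2) by blast
        moreover have "i \<in> z" using that a by auto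
        ultimately show False using i by auto
      qed
      then show ?thesis unfolding Q_def using a by auto
    qed
    have bounded: "\<And>x. Q x \<Longrightarrow> x \<le> i" by (simp add: Q_def)
    \<comment> \<open>The shortest uncovered interval ending at \<open>i\<close> now has the
      greatest possible left end, and \<open>i\<close> bounds the search.\<close>
    define x where "x = (GREATEST x. Q x)"
    have Qx: "Q x" unfolding x_def using Qa bounded by (rule GreatestI_nat)
    have ax: "a \<le> x" unfolding x_def using Qa bounded by (rule Greatest_le_nat)
    have "\<not> Q i" using iA by (auto simp: Q_def)
    then have xi: "x < i" using Qx by (auto simp: Q_def le_eq_less_or_eq)
    have "\<not> Q (Suc x)" using Greatest_le_nat[of Q "Suc x" i] bounded unfolding x_def by auto
    moreover have "\<exists>z\<in>A. {x..i-1} \<subseteq> z" using ax a(2) by (intro bexI[of _ "{a..i-1}"]) auto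
    ultimately have "{x..i} \<in> antichain_rowmotion (root_poset m) A"
      using i xi ax a1 Qx a by (subst interval_in_rowmotion_iff) (auto simp: Q_def)
    then show ?thesis using xi by (auto simp: right_ends_def intro!: exI[of _ x])
  qed
qed

section \<open>Excedances of 321-avoiding permutations\<close>

text \<open>Pigeonhole: otherwise \<open>j\<close> and the first \<open>p\<close> positions, more
  than \<open>m\<close> in all, would map injectively into \<open>{1..m}\<close>.\<close>

lemma permutes_exceed_prefix:
  fixes \<pi> :: "nat \<Rightarrow> nat"
  assumes "\<pi> permutes {1..n}" "m \<le> p" "p < j" "j \<le> n" "\<pi> j \<le> m"
  shows "\<exists>k\<in>{1..p}. m < \<pi> k"
proof (rule ccontr)
  assume "\<not> ?thesis"
  then have "\<pi> ` insert j {1..p} \<subseteq> {1..m}"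
    using assms permutes_in_image[OF assms(1)] by (fastforce simp: not_less)
  then have "card (insert j {1..p}) \<le> card {1..m}"
    using card_inj_on_le[of \<pi> "insert j {1..p}" "{1..m}"] permutes_inj_on[OF assms(1)] by auto
  then show False using assms by auto
qed

text \<open>The complementary count: otherwise \<open>k\<close> and the \<open>n - p\<close>
  positions after \<open>p\<close> would map injectively into the \<open>n - m\<close> values above
  \<open>m\<close>.\<close>

lemma permutes_small_after:
  fixes \<pi> :: "nat \<Rightarrow> nat"
  assumes "\<pi> permutes {1..n}" "p \<le> m" "1 \<le> k" "k \<le> p" "m < \<pi> k" "p \<le> n"
  shows "\<exists>j\<in>{p<..n}. \<pi> j \<le> m"
proof (rule ccontr)
  assume "\<not> ?thesis"
  then have "\<pi> ` insert k {p<..n} \<subseteq> {m<..n}"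
    using assms permutes_in_image[OF assms(1)] by (fastforce simp: not_le)
  then have "card (insert k {p<..n}) \<le> card {m<..n}"
    using card_inj_on_le[of \<pi> "insert k {p<..n}" "{m<..n}"] permutes_inj_on[OF assms(1)] by auto
  then show False using assms by auto
qed

lemma S321_permutes: "\<pi> \<in> S321 n \<Longrightarrow> \<pi> permutes {1..n}"
  by (simp add: S321_def)

lemma S321_avoids:
  "\<pi> \<in> S321 n \<Longrightarrow> 1 \<le> i \<Longrightarrow> i < j \<Longrightarrow> j < k \<Longrightarrow> k \<le> n \<Longrightarrow> \<pi> j < \<pi> i \<Longrightarrow> \<pi> k < \<pi> j \<Longrightarrow> False"
  unfolding S321_def by fastforce

lemma S321_eqD: "\<pi> \<in> S321 n \<Longrightarrow> \<pi> x = \<pi> y \<Longrightarrow> x = y"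
  using permutes_inj[OF S321_permutes] by (meson injD)

lemma finite_S321: "finite (S321 n)"
  by (rule finite_subset[OF _ finite_permutations[of "{1..n}"]]) (auto simp: S321_def)

text \<open>If \<open>\<pi> i > \<pi> j\<close>, counting values up to \<open>\<pi> j - 1\<close>,
  which is still at least \<open>j\<close>, gives a later \<open>k\<close> with
  \<open>\<pi> k < \<pi> j\<close>; then \<open>i, j, k\<close> form a 321.\<close>

lemma S321_excedances_increasing:
  assumes \<pi>: "\<pi> \<in> S321 n" and ij: "1 \<le> i" "i < j" "j \<le> n" and exc: "j < \<pi> j"
  shows "\<pi> i < \<pi> j"
proof (rule ccontr)
  assume "\<not> ?thesis"
  then have gt: "\<pi> j < \<pi> i" using S321_eqD[OF \<pi>, of i j] ij by force
  obtain k where k: "k \<in> {j<..n}" "\<pi> k \<le> \<pi> j - 1"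
    using permutes_small_after[OF S321_permutes[OF \<pi>], of j "\<pi> j - 1" i] ij exc gt by fastforce
  then have "\<pi> k < \<pi> j" using exc by linarith
  then show False using S321_avoids[OF \<pi>, of i j k] ij k gt by auto
qed

text \<open>If \<open>\<pi> j < \<pi> i\<close>, counting over the first \<open>i - 1\<close>
  positions gives \<open>k < i\<close> with \<open>\<pi> k > \<pi> i\<close>; then
  \<open>k, i, j\<close> form a 321.\<close>

lemma S321_nonexcedances_increasing:
  assumes \<pi>: "\<pi> \<in> S321 n" and ij: "1 \<le> i" "i < j" "j \<le> n" and exc: "\<pi> i \<le> i"
  shows "\<pi> i < \<pi> j"
proof (rule ccontr)
  assume "\<not> ?thesis"
  then have gt: "\<pi> j < \<pi> i" using S321_eqD[OF \<pi>, of i j] ij by force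
  obtain k where k: "k \<in> {1..i-1}" "\<pi> i - 1 < \<pi> k"
    using permutes_exceed_prefix[OF S321_permutes[OF \<pi>], of "\<pi> i - 1" "i - 1" j] ij exc gt by fastforce
  then have "\<pi> i \<noteq> \<pi> k" using S321_eqD[OF \<pi>, of i k] by auto
  then have "\<pi> i < \<pi> k" "k < i" using k ij by auto
  then show False using S321_avoids[OF \<pi>, of k i j] ij k gt by auto
qed

section \<open>The map \<open>Exc\<close>: its values are antichains, and it is injective\<close>

lemma interval_in_Exc_iff:
  assumes "a \<le> b"
  shows "{a..b} \<in> Exc n \<pi> \<longleftrightarrow> 1 \<le> a \<and> a \<le> n \<and> \<pi> a = Suc b"
proof
  assume "{a..b} \<in> Exc n \<pi>"
  then show "1 \<le> a \<and> a \<le> n \<and> \<pi> a = Suc b"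
    using assms by (auto simp: Exc_def Icc_eq_Icc)
next
  assume "1 \<le> a \<and> a \<le> n \<and> \<pi> a = Suc b"
  then show "{a..b} \<in> Exc n \<pi>" using assms unfolding Exc_def by (intro CollectI exI[of _ a]) auto
qed

lemma ExcE:
  assumes "x \<in> Exc n \<pi>"
  obtains a where "x = {a..\<pi> a - 1}" "1 \<le> a" "a \<le> n" "a < \<pi> a"
  using assms unfolding Exc_def by auto

lemma Exc_in_antichains:
  assumes \<pi>: "\<pi> \<in> S321 n"
  shows "Exc n \<pi> \<in> antichains (root_poset (n - 1))"
proof -
  have "x \<in> root_poset (n - 1)" if x: "x \<in> Exc n \<pi>" for x
  proof -
    obtain a where a: "x = {a..\<pi> a - 1}" "1 \<le> a" "a \<le> n" "a < \<pi> a" using x by (rule ExcE)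
    have "\<pi> a \<le> n" using a permutes_in_image[OF S321_permutes[OF \<pi>], of a] by auto
    then show ?thesis using a by (auto simp: interval_in_root_poset_iff)
  qed
  moreover have "x = y" if xy: "x \<in> Exc n \<pi>" "y \<in> Exc n \<pi>" "x \<subseteq> y" for x y
  proof -
    obtain a where a: "x = {a..\<pi> a - 1}" "1 \<le> a" "a \<le> n" "a < \<pi> a" using xy(1) by (rule ExcE)
    obtain b where b: "y = {b..\<pi> b - 1}" "1 \<le> b" "b \<le> n" "b < \<pi> b" using xy(2) by (rule ExcE)
    have "b \<le> a" "\<pi> a \<le> \<pi> b" using xy(3) a b by auto
    then have "a = b" using S321_excedances_increasing[OF \<pi>, of b a] a b by force
    then show ?thesis using a b by simp
  qed
  ultimately show ?thesis by (auto simp: antichains_def)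
qed

lemma Exc_determines_excedances:
  assumes "Exc n \<pi> = Exc n \<sigma>" "1 \<le> i" "i \<le> n" "i < \<pi> i"
  shows "\<sigma> i = \<pi> i"
proof -
  have "{i..\<pi> i - 1} \<in> Exc n \<sigma>" using assms interval_in_Exc_iff[of i "\<pi> i - 1" n \<pi>] by auto
  then show ?thesis using assms interval_in_Exc_iff[of i "\<pi> i - 1" n \<sigma>] by auto
qed

text \<open>\<open>Exc\<close> fixes the excedances with their values, and the other values occur in
  increasing order. The proof looks at the first disagreement.\<close>

lemma Exc_inj_on: "inj_on (Exc n) (S321 n)"
proof (rule inj_onI, rule ccontr)
  fix \<pi> \<sigma> assume \<pi>: "\<pi> \<in> S321 n" and \<sigma>: "\<sigma> \<in> S321 n"
    and eq: "Exc n \<pi> = Exc n \<sigma>" and ne: "\<pi> \<noteq> \<sigma>"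
  define x where "x = (LEAST x. \<pi> x \<noteq> \<sigma> x)"
  have x: "\<pi> x \<noteq> \<sigma> x"
    using LeastI_ex[of "\<lambda>x. \<pi> x \<noteq> \<sigma> x"] ne unfolding x_def by blast
  have below: "\<pi> y = \<sigma> y" if "y < x" for y
    using not_less_Least[of y "\<lambda>x. \<pi> x \<noteq> \<sigma> x"] that unfolding x_def by simp
  have xn: "x \<in> {1..n}"
    using x S321_permutes[OF \<pi>] S321_permutes[OF \<sigma>] by (metis permutes_not_in)
  \<comment> \<open>Stated for arbitrary permutations so that it serves both orders at
    \<open>x\<close>. The permutation with the larger value has no excedance there, and takes the
    smaller value only later, against monotonicity.\<close>
  have *: False if \<pi>: "\<pi> \<in> S321 n" and \<sigma>: "\<sigma> \<in> S321 n" and eq: "Exc n \<pi> = Exc n \<sigma>"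
    and less: "\<pi> x < \<sigma> x" and below: "\<And>y. y < x \<Longrightarrow> \<pi> y = \<sigma> y" for \<pi> \<sigma>
  proof -
    have nexc: "\<sigma> x \<le> x"
      using Exc_determines_excedances[OF eq[symmetric], of x] less xn by force
    define y where "y = inv \<sigma> (\<pi> x)"
    have "\<sigma> y = \<pi> x" unfolding y_def by (rule permutes_inverses(1)[OF S321_permutes[OF \<sigma>]])
    moreover from this have "y \<in> {1..n}"
      using xn permutes_in_image[OF S321_permutes[OF \<pi>]] permutes_in_image[OF S321_permutes[OF \<sigma>]]
      by metis
    ultimately have y: "\<sigma> y = \<pi> x" "y \<in> {1..n}" by simp_all
    have "y \<noteq> x" using y less by auto
    moreover have "\<not> y < x"
    proof
      assume "y < x"
      then have "\<pi> y = \<pi> x" using y below by simp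
      then show False using S321_eqD[OF \<pi>] \<open>y < x\<close> by blast
    qed
    ultimately have "x < y" by simp
    then show False using S321_nonexcedances_increasing[OF \<sigma>, of x y] nexc xn y less by auto
  qed
  show False
  proof (cases "\<pi> x < \<sigma> x")
    case True
    show False by (rule *[OF \<pi> \<sigma> eq True below])
  next
    case False
    then have "\<sigma> x < \<pi> x" using x by simp
    then show False by (rule *[OF \<sigma> \<pi> eq[symmetric] _ below[symmetric]])
  qed
qed

section \<open>Constructing a 321-avoiding permutation with prescribed excedances\<close>

lemma ex_strict_mono_bij_betw:
  fixes X Y :: "nat set"
  assumes "finite X" "finite Y" "card X = card Y"
  shows "\<exists>g. bij_betw g X Y \<and> strict_mono_on X g"
proof -
  obtain h where h: "bij_betw h {..<card X} X" "strict_mono_on {..<card X} h"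
    using ex_bij_betw_strict_mono_card[OF assms(1)] by metis
  obtain k where k: "bij_betw k {..<card X} Y" "strict_mono_on {..<card X} k"
    using ex_bij_betw_strict_mono_card[OF assms(2)] assms(3) by metis
  define h' where "h' = inv_into {..<card X} h"
  have h': "bij_betw h' X {..<card X}" unfolding h'_def by (rule bij_betw_inv_into[OF h(1)])
  have "strict_mono_on X (k \<circ> h')"
  proof (rule strict_mono_onI)
    fix x y assume xy: "x \<in> X" "y \<in> X" "x < y"
    have mem: "h' x \<in> {..<card X}" "h' y \<in> {..<card X}" using h' xy bij_betwE by blast+
    have inv: "h (h' x) = x" "h (h' y) = y"
      unfolding h'_def using xy h(1) by (simp_all add: bij_betw_inv_into_right)
    have "h' x < h' y"
    proof (rule ccontr)
      assume "\<not> ?thesis"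
      then have "h (h' y) \<le> h (h' x)"
        using strict_mono_onD[OF h(2) mem(2) mem(1)] by (cases "h' x = h' y") auto
      then show False using inv xy by simp
    qed
    then show "(k \<circ> h') x < (k \<circ> h') y" using strict_mono_onD[OF k(2) mem] by simp
  qed
  moreover have "bij_betw (k \<circ> h') X Y" using bij_betw_trans[OF h' k(1)] .
  ultimately show ?thesis by blast
qed

text \<open>\<open>A\<close> prescribes the values at its left ends; the remaining values fill the
  remaining positions in increasing order. The main point is that the filled positions are not
  excedances.\<close>

lemma Exc_surj:
  assumes A: "A \<in> antichains (root_poset (n - 1))"
  shows "\<exists>\<pi>\<in>S321 n. Exc n \<pi> = A"
proof -
  define L where "L = left_ends A"
  have "\<forall>a\<in>L. \<exists>b. a \<le> b \<and> {a..b} \<in> A" by (auto simp: L_def left_ends_def)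
  then obtain b where b: "\<And>a. a \<in> L \<Longrightarrow> a \<le> b a" "\<And>a. a \<in> L \<Longrightarrow> {a..b a} \<in> A" by metis
  have bounds: "1 \<le> a \<and> b a \<le> n - 1" if "a \<in> L" for a
    using b[OF that] antichains_subset[OF A] interval_in_root_poset_iff by blast
  \<comment> \<open>Intervals with a common left end are nested, so in an antichain the left end
    determines the right one.\<close>
  have b_unique: "d = b a" "a \<in> L" if "{a..d} \<in> A" "a \<le> d" for a d
  proof -
    show aL: "a \<in> L" using that by (auto simp: L_def left_ends_def)
    have "{a..d} \<subseteq> {a..b a} \<or> {a..b a} \<subseteq> {a..d}" by auto
    then have "{a..d} = {a..b a}"
      using antichainsD[OF A that(1) b(2)[OF aL]] antichainsD[OF A b(2)[OF aL] that(1)] by metis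
    then show "d = b a" using that(2) by (auto simp: Icc_eq_Icc)
  qed
  have b_mono: "b x < b y" if xy: "x \<in> L" "y \<in> L" "x < y" for x y
  proof (rule ccontr)
    assume "\<not> ?thesis"
    then have "{y..b y} = {x..b x}" using antichainsD[OF A b(2)[OF xy(2)] b(2)[OF xy(1)]] xy by auto
    then show False using b(1)[OF xy(2)] xy by (auto simp: Icc_eq_Icc)
  qed
  have b_inj: "inj_on (\<lambda>x. Suc (b x)) L"
    by (rule inj_onI) (metis b_mono less_irrefl nat.inject nat_neq_iff)
  define V where "V = (\<lambda>x. Suc (b x)) ` L"
  have Ln: "L \<subseteq> {1..n}" using bounds b(1) by fastforce
  have finL: "finite L" by (rule finite_subset[OF Ln]) simp
  have Vn: "V \<subseteq> {1..n}" using bounds b(1) by (fastforce simp: V_def)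
  have "card V = card L" unfolding V_def by (rule card_image[OF b_inj])
  then have "card ({1..n} - L) = card ({1..n} - V)"
    using Ln Vn by (simp add: card_Diff_subset finite_subset)
  then obtain g where g: "bij_betw g ({1..n} - L) ({1..n} - V)" "strict_mono_on ({1..n} - L) g"
    using ex_strict_mono_bij_betw by blast
  \<comment> \<open>Suppose \<open>g x > x\<close>. By monotonicity the values up to
    \<open>x\<close> outside \<open>V\<close> all come from positions before \<open>x\<close>
    outside \<open>L\<close>, so \<open>{1..x}\<close> has fewer points outside \<open>V\<close>
    than outside \<open>L\<close>. But each value of \<open>V\<close> up to \<open>x\<close> comes
    from a smaller position in \<open>L\<close>, which gives the opposite comparison.\<close>
  have g_le: "g x \<le> x" if x: "x \<in> {1..n} - L" for x
  proof (rule ccontr)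
    assume gx: "\<not> g x \<le> x"
    have "V \<inter> {1..x} \<subseteq> (\<lambda>x. Suc (b x)) ` (L \<inter> {1..x})"
      using b(1) bounds by (fastforce simp: V_def)
    then have VL: "card (V \<inter> {1..x}) \<le> card (L \<inter> {1..x})"
      using finL by (meson surj_card_le finite_Int)
    have "{1..x} - V \<subseteq> g ` ({1..<x} - L)"
    proof
      fix z assume z: "z \<in> {1..x} - V"
      then have "z \<in> {1..n} - V" using x by auto
      then have "z \<in> g ` ({1..n} - L)" using g(1) by (simp only: bij_betw_imp_surj_on)
      then obtain y where y: "y \<in> {1..n} - L" "z = g y" by blast
      have "y < x"
      proof (rule ccontr)
        assume "\<not> ?thesis"
        then have "g x \<le> g y" using strict_mono_onD[OF g(2) x y(1)] by (cases "x = y") auto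
        then show False using z y gx by auto
      qed
      then show "z \<in> g ` ({1..<x} - L)" using y by auto
    qed
    then have "card ({1..x} - V) \<le> card ({1..<x} - L)"
      by (meson surj_card_le finite_Diff finite_atLeastLessThan)
    also have "\<dots> < card ({1..x} - L)" by (rule psubset_card_mono) (use x in auto)
    finally have "card ({1..x} - V) < card ({1..x} - L)" .
    moreover have "card ({1..x} - V) = x - card (V \<inter> {1..x})"
      "card ({1..x} - L) = x - card (L \<inter> {1..x})"
      by (simp_all add: card_Diff_subset_Int Int_commute)
    ultimately show False using VL by linarith
  qed
  define \<pi> where "\<pi> x = (if x \<in> L then Suc (b x) else if x \<in> {1..n} then g x else x)" for x
  have \<pi>L: "\<pi> x = Suc (b x)" if "x \<in> L" for x using that by (simp add: \<pi>_def)
  have \<pi>g: "\<pi> x = g x" if "x \<in> {1..n} - L" for x using that by (simp add: \<pi>_def)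
  have "bij_betw \<pi> L V" using b_inj \<pi>L unfolding V_def bij_betw_def
    by (metis (no_types, lifting) image_cong inj_on_cong)
  moreover have "bij_betw \<pi> ({1..n} - L) ({1..n} - V)"
    using g(1) \<pi>g by (metis (no_types, lifting) bij_betw_cong)
  ultimately have "bij_betw \<pi> (L \<union> ({1..n} - L)) (V \<union> ({1..n} - V))" by (rule bij_betw_combine) auto
  moreover have "L \<union> ({1..n} - L) = {1..n}" "V \<union> ({1..n} - V) = {1..n}" using Ln Vn by auto
  ultimately have "bij_betw \<pi> {1..n} {1..n}" by simp
  then have perm: "\<pi> permutes {1..n}"
    by (rule bij_imp_permutes) (use Ln in \<open>auto simp: \<pi>_def\<close>)
  have incL: "\<pi> x < \<pi> y" if "x \<in> L" "y \<in> L" "x < y" for x y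
    using that b_mono \<pi>L by auto
  have incC: "\<pi> x < \<pi> y" if "x \<in> {1..n} - L" "y \<in> {1..n} - L" "x < y" for x y
    using that strict_mono_onD[OF g(2)] \<pi>g by auto
  \<comment> \<open>Two of the three positions lie both in \<open>L\<close> or both outside it, and
    \<open>\<pi>\<close> increases on each of these sets.\<close>
  have False if "i \<in> {1..n}" "j \<in> {1..n}" "k \<in> {1..n}"
    "i < j" "j < k" "\<pi> j < \<pi> i" "\<pi> k < \<pi> j" for i j k
    using that incL[of i j] incL[of j k] incL[of i k] incC[of i j] incC[of j k] incC[of i k]
    by (meson DiffI less_asym less_trans)
  then have "\<pi> \<in> S321 n" using perm unfolding S321_def by blast
  moreover have "Exc n \<pi> = A"
  proof (intro equalityI subsetI)
    fix x assume "x \<in> Exc n \<pi>"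
    then obtain a where a: "x = {a..\<pi> a - 1}" "1 \<le> a" "a \<le> n" "a < \<pi> a" by (rule ExcE)
    have "a \<in> L" using g_le[of a] a \<pi>g[of a] by force
    then show "x \<in> A" using b(2) a \<pi>L by auto
  next
    fix x assume "x \<in> A"
    then obtain a d where ad: "x = {a..d}" "a \<le> d"
      using interval_antichainE[OF A] by metis
    then have "d = b a" "a \<in> L" using b_unique \<open>x \<in> A\<close> by auto
    then show "x \<in> Exc n \<pi>" using ad \<pi>L Ln by (auto simp: interval_in_Exc_iff)
  qed
  ultimately show ?thesis by blast
qed

section \<open>Rowmotion on 321-avoiding permutations\<close>

text \<open>Surjectivity of \<open>Exc\<close> puts the rowmotion image in its range, so
  \<open>inv_into\<close> is a genuine preimage.\<close>

lemma rowmotion_S: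
  assumes "\<pi> \<in> S321 n"
  shows rowmotion_S_in_S321: "rowmotion_S n \<pi> \<in> S321 n"
    and Exc_rowmotion_S:
      "Exc n (rowmotion_S n \<pi>) = antichain_rowmotion (root_poset (n - 1)) (Exc n \<pi>)"
proof -
  let ?B = "antichain_rowmotion (root_poset (n - 1)) (Exc n \<pi>)"
  obtain \<sigma> where "\<sigma> \<in> S321 n" "Exc n \<sigma> = ?B"
    using Exc_surj[OF antichain_rowmotion_in_antichains] by blast
  then have "?B \<in> Exc n ` S321 n" by (metis imageI)
  then show "rowmotion_S n \<pi> \<in> S321 n" "Exc n (rowmotion_S n \<pi>) = ?B"
    unfolding rowmotion_S_def by (simp_all add: inv_into_into f_inv_into_f)
qed

lemma rowmotion_S_inj_on: "inj_on (rowmotion_S n) (S321 n)"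
proof (rule inj_onI)
  fix \<pi> \<sigma> assume \<pi>: "\<pi> \<in> S321 n" and \<sigma>: "\<sigma> \<in> S321 n"
    and eq: "rowmotion_S n \<pi> = rowmotion_S n \<sigma>"
  have "antichain_rowmotion (root_poset (n - 1)) (Exc n \<pi>)
      = antichain_rowmotion (root_poset (n - 1)) (Exc n \<sigma>)"
    using Exc_rowmotion_S[OF \<pi>] Exc_rowmotion_S[OF \<sigma>] eq by simp
  then have "Exc n \<pi> = Exc n \<sigma>"
    using antichain_rowmotion_inj[OF finite_root_poset] Exc_in_antichains \<pi> \<sigma> by (meson inj_onD)
  then show "\<pi> = \<sigma>" using Exc_inj_on \<pi> \<sigma> by (meson inj_onD)
qed

text \<open>An interval meeting \<open>i - 1\<close> or \<open>i\<close> at a fixed point comes from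
  \<open>a < i < \<pi> a\<close>; a count gives a later \<open>j\<close> with
  \<open>\<pi> j < i\<close>, and \<open>a, i, j\<close> form a 321. Conversely,
  \<open>\<pi> i > i\<close> covers \<open>i\<close>, while \<open>\<pi> i < i\<close> forces an
  earlier position with value at least \<open>i\<close>, whose interval contains
  \<open>i - 1\<close>.\<close>

lemma S321_fixed_iff:
  assumes \<pi>: "\<pi> \<in> S321 n" and i: "1 \<le> i" "i \<le> n"
  shows "\<pi> i = i \<longleftrightarrow> i \<notin> \<Union>(Exc n \<pi>) \<and> i - 1 \<notin> \<Union>(Exc n \<pi>)"
proof
  assume fix_i: "\<pi> i = i"
  have False if x: "x \<in> Exc n \<pi>" "i \<in> x \<or> i - 1 \<in> x" for x
  proof -
    obtain a where a: "x = {a..\<pi> a - 1}" "1 \<le> a" "a \<le> n" "a < \<pi> a" using x(1) by (rule ExcE)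
    have "a \<noteq> i" using a fix_i by auto
    moreover have "\<pi> a \<noteq> i" using \<open>a \<noteq> i\<close> fix_i S321_eqD[OF \<pi>, of a i] by auto
    ultimately have ai: "a < i" "i < \<pi> a" using x a i by auto
    obtain j where j: "j \<in> {i<..n}" "\<pi> j \<le> i"
      using permutes_small_after[OF S321_permutes[OF \<pi>], of i i a] ai a i by auto
    then have "\<pi> j \<noteq> \<pi> i" using S321_eqD[OF \<pi>, of j i] by auto
    then show False using S321_avoids[OF \<pi>, of a i j] a ai j fix_i by auto
  qed
  then show "i \<notin> \<Union>(Exc n \<pi>) \<and> i - 1 \<notin> \<Union>(Exc n \<pi>)" by blast
next
  assume r: "i \<notin> \<Union>(Exc n \<pi>) \<and> i - 1 \<notin> \<Union>(Exc n \<pi>)"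
  have notin: False if "1 \<le> a" "a \<le> i" "i < \<pi> a \<or> a < i \<and> i = \<pi> a" for a
  proof -
    have "{a..\<pi> a - 1} \<in> Exc n \<pi>" using that i by (subst interval_in_Exc_iff) auto
    moreover have "i \<in> {a..\<pi> a - 1} \<or> i - 1 \<in> {a..\<pi> a - 1}" using that by auto
    ultimately show False using r by blast
  qed
  have "\<not> \<pi> i < i"
  proof
    assume less: "\<pi> i < i"
    have "\<exists>a\<in>{1..i-1}. i - 1 < \<pi> a"
      by (rule permutes_exceed_prefix[OF S321_permutes[OF \<pi>], where j = i]) (use i less in auto)
    then obtain a where "a \<in> {1..i-1}" "i - 1 < \<pi> a" by blast
    then have "1 \<le> a" "a < i" "i \<le> \<pi> a" using i by auto
    then show False using notin[of a] by linarith
  qed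
  moreover have "\<not> i < \<pi> i" using notin[of i] i by auto
  ultimately show "\<pi> i = i" by simp
qed

section \<open>The statistic \<open>ell\<close> in terms of end points\<close>

lemma left_ends_Exc: "i \<in> left_ends (Exc n \<pi>) \<longleftrightarrow> 1 \<le> i \<and> i \<le> n \<and> i < \<pi> i"
proof
  assume "i \<in> left_ends (Exc n \<pi>)"
  then show "1 \<le> i \<and> i \<le> n \<and> i < \<pi> i" by (auto simp: left_ends_def interval_in_Exc_iff)
next
  assume "1 \<le> i \<and> i \<le> n \<and> i < \<pi> i"
  then show "i \<in> left_ends (Exc n \<pi>)"
    by (auto simp: left_ends_def interval_in_Exc_iff intro!: exI[of _ "\<pi> i - 1"])
qed

lemma right_ends_Exc:
  assumes "\<pi> permutes {1..n}" "1 \<le> i" "i \<le> n"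
  shows "i - 1 \<in> right_ends (Exc n \<pi>) \<longleftrightarrow> inv \<pi> i < i"
proof
  assume "i - 1 \<in> right_ends (Exc n \<pi>)"
  then obtain a where "a \<le> i - 1" "\<pi> a = Suc (i - 1)"
    by (auto simp: right_ends_def interval_in_Exc_iff)
  then have "\<pi> a = i" "a < i" using assms by auto
  then show "inv \<pi> i < i" using permutes_inverses(2)[OF assms(1), of a] by simp
next
  assume *: "inv \<pi> i < i"
  have "inv \<pi> i \<in> {1..n}" using permutes_in_image[OF permutes_inv[OF assms(1)]] assms by simp
  then have "{inv \<pi> i..i - 1} \<in> Exc n \<pi>"
    using * assms permutes_inverses(1)[OF assms(1), of i] by (subst interval_in_Exc_iff) auto
  moreover have "inv \<pi> i \<le> i - 1" using * by simp
  ultimately show "i - 1 \<in> right_ends (Exc n \<pi>)" unfolding right_ends_def by blast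
qed

lemma ell_eq_ends:
  assumes \<pi>: "\<pi> \<in> S321 n" and i: "1 \<le> i" "i \<le> n"
  shows "ell i \<pi> = of_bool (i - 1 \<in> right_ends (Exc n \<pi>)) + of_bool (\<pi> i = i)
    + of_bool (i \<in> left_ends (Exc n \<pi>))"
proof -
  have "inv \<pi> i = i \<longleftrightarrow> \<pi> i = i" using permutes_inverses[OF S321_permutes[OF \<pi>], of i] by metis
  then have "of_bool (inv \<pi> i \<le> i) = (of_bool (inv \<pi> i < i) + of_bool (\<pi> i = i) :: nat)"
    by (auto simp: of_bool_def)
  then show ?thesis
    using right_ends_Exc[OF S321_permutes[OF \<pi>] i] left_ends_Exc[of i n \<pi>] i by (simp add: ell_def)
qed

text \<open>Rowmotion merges the terms for the right end \<open>i - 1\<close> and the fixed point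
  \<open>i\<close> into one right end \<open>i\<close>. The bound \<open>i < n\<close> keeps
  \<open>i\<close> inside the poset on \<open>{1..n - 1}\<close>.\<close>

lemma ell_conv_right_rowmotion:
  assumes \<pi>: "\<pi> \<in> S321 n" and i: "1 \<le> i" "i < n"
  shows "ell i \<pi> = of_bool (i \<in> left_ends (Exc n \<pi>))
    + of_bool (i \<in> right_ends (Exc n (rowmotion_S n \<pi>)))"
proof -
  have "i \<in> right_ends (Exc n (rowmotion_S n \<pi>)) \<longleftrightarrow> i - 1 \<in> right_ends (Exc n \<pi>) \<or> \<pi> i = i"
    using right_ends_rowmotion[OF Exc_in_antichains[OF \<pi>], of i] Exc_rowmotion_S[OF \<pi>] i
      S321_fixed_iff[OF \<pi>, of i] by (simp del: Union_iff)
  \<comment> \<open>A right end is covered, whereas a fixed point \<open>i\<close> leaves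
    \<open>i - 1\<close> uncovered; so the two indicators add up to that of the disjunction.\<close>
  moreover have "\<not> (i - 1 \<in> right_ends (Exc n \<pi>) \<and> \<pi> i = i)"
    using S321_fixed_iff[OF \<pi>, of i] i by (auto simp: right_ends_def)
  ultimately show ?thesis using ell_eq_ends[OF \<pi>, of i] i by (auto simp: of_bool_def)
qed

lemma ell_Suc_conv_left_rowmotion:
  assumes \<pi>: "\<pi> \<in> S321 n" and i: "1 \<le> i" "i < n"
  shows "ell (Suc i) \<pi> = of_bool (i \<in> right_ends (Exc n \<pi>))
    + of_bool (i \<in> left_ends (Exc n (rowmotion_S n \<pi>)))"
proof -
  have "i \<in> left_ends (Exc n (rowmotion_S n \<pi>)) \<longleftrightarrow>
      Suc i \<in> left_ends (Exc n \<pi>) \<or> \<pi> (Suc i) = Suc i"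
    using left_ends_rowmotion[OF Exc_in_antichains[OF \<pi>], of i] Exc_rowmotion_S[OF \<pi>] i
      S321_fixed_iff[OF \<pi>, of "Suc i"] by (simp add: conj_commute del: Union_iff)
  moreover have "\<not> (Suc i \<in> left_ends (Exc n \<pi>) \<and> \<pi> (Suc i) = Suc i)"
    by (auto simp: left_ends_Exc)
  ultimately show ?thesis using ell_eq_ends[OF \<pi>, of "Suc i"] i by (auto simp: of_bool_def)
qed

text \<open>\<open>inv \<pi> 1 \<le> 1\<close> means that \<open>1\<close> is fixed, and otherwise
  \<open>\<pi> 1 > 1\<close>: exactly one term counts.\<close>

lemma ell_1:
  assumes \<pi>: "\<pi> \<in> S321 n" and "1 \<le> n"
  shows "ell 1 \<pi> = 1"
proof -
  have "inv \<pi> 1 \<in> {1..n}" "\<pi> 1 \<in> {1..n}"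
    using permutes_in_image[OF permutes_inv[OF S321_permutes[OF \<pi>]], of 1]
      permutes_in_image[OF S321_permutes[OF \<pi>], of 1] assms by auto
  moreover have "inv \<pi> 1 = 1 \<longleftrightarrow> \<pi> 1 = 1"
    using permutes_inverses[OF S321_permutes[OF \<pi>], of 1] by metis
  ultimately show ?thesis by (auto simp: ell_def of_bool_def)
qed

section \<open>Orbit sums\<close>

lemma orbit_subset:
  assumes "f ` S \<subseteq> S" "x \<in> S"
  shows "orbit f x \<subseteq> S"
proof
  fix y assume "y \<in> orbit f x"
  then show "y \<in> S" by induction (use assms in auto)
qed

text \<open>An injective self-map of a finite orbit permutes it, so the sum is merely
  reindexed.\<close>

lemma sum_orbit_shift:
  assumes "finite S" "inj_on f S" "f ` S \<subseteq> S" "x \<in> S"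
  shows "(\<Sum>y\<in>orbit f x. g (f y)) = (\<Sum>y\<in>orbit f x. g y)"
proof -
  have sub: "orbit f x \<subseteq> S" using assms by (intro orbit_subset)
  have inj: "inj_on f (orbit f x)" using assms(2) sub by (rule inj_on_subset)
  have "f ` orbit f x = orbit f x"
    by (rule endo_inj_surj[OF finite_subset[OF sub assms(1)] _ inj]) (auto intro: orbit.intros)
  then show ?thesis using sum.reindex[OF inj, of g] by simp
qed

lemma sum_ell_orbit:
  assumes \<sigma>: "\<sigma> \<in> S321 n" and "1 \<le> i" "i \<le> n"
  shows "(\<Sum>\<pi>\<in>orbit (rowmotion_S n) \<sigma>. ell i \<pi>) = card (orbit (rowmotion_S n) \<sigma>)"
proof -
  let ?O = "orbit (rowmotion_S n) \<sigma>"
  have maps: "rowmotion_S n ` S321 n \<subseteq> S321 n" by (auto intro: rowmotion_S_in_S321)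
  have sub: "\<pi> \<in> S321 n" if "\<pi> \<in> ?O" for \<pi> using orbit_subset[OF maps \<sigma>] that by blast
  note shift = sum_orbit_shift[OF finite_S321 rowmotion_S_inj_on maps \<sigma>]
  show ?thesis using assms(2,3)
  proof (induction i rule: dec_induct)
    case base
    have "(\<Sum>\<pi>\<in>?O. ell 1 \<pi>) = (\<Sum>\<pi>\<in>?O. 1)"
      by (rule sum.cong[OF refl], rule ell_1[OF sub]) (use assms in auto)
    then show ?case by simp
  next
    case (step i)
    let ?l = "\<lambda>\<pi>. of_bool (i \<in> left_ends (Exc n \<pi>)) :: nat"
    let ?r = "\<lambda>\<pi>. of_bool (i \<in> right_ends (Exc n \<pi>)) :: nat"
    have i: "1 \<le> i" "i < n" using step by auto
    have "(\<Sum>\<pi>\<in>?O. ell (Suc i) \<pi>) = (\<Sum>\<pi>\<in>?O. ?r \<pi> + ?l (rowmotion_S n \<pi>))"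
      by (rule sum.cong[OF refl], rule ell_Suc_conv_left_rowmotion[OF sub i])
    \<comment> \<open>Reindexing removes rowmotion from the left-end term and introduces it in the
      right-end term.\<close>
    also have "\<dots> = (\<Sum>\<pi>\<in>?O. ?l \<pi> + ?r (rowmotion_S n \<pi>))"
      using shift[of ?l] shift[of ?r] by (simp only: sum.distrib add.commute)
    also have "\<dots> = (\<Sum>\<pi>\<in>?O. ell i \<pi>)"
      by (rule sum.cong[OF refl], rule ell_conv_right_rowmotion[OF sub i, symmetric])
    also have "\<dots> = card ?O" using step by simp
    finally show ?case .
  qed
qed

theorem theorem4p3:
  fixes n i :: nat
  assumes "1 \<le> n" and "1 \<le> i" and "i \<le> n"
  shows "mesic 1 (ell i) (rowmotion_S n) (S321 n)"
  unfolding mesic_def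
proof
  fix O' assume "O' \<in> orbit (rowmotion_S n) ` S321 n"
  then obtain \<sigma> where \<sigma>: "\<sigma> \<in> S321 n" and O': "O' = orbit (rowmotion_S n) \<sigma>" by blast
  have "O' \<subseteq> S321 n" unfolding O' by (rule orbit_subset[OF _ \<sigma>]) (auto intro: rowmotion_S_in_S321)
  then have "finite O'" using finite_S321 by (rule finite_subset)
  \<comment> \<open>With finiteness this makes the cardinality nonzero, so the division in
    \<open>mesic\<close> is a true average.\<close>
  moreover have "O' \<noteq> {}" unfolding O' by (auto intro: orbit.intros)
  ultimately have "card O' \<noteq> 0" by simp
  moreover have "(\<Sum>\<pi>\<in>O'. real (ell i \<pi>)) = real (card O')"
    using sum_ell_orbit[OF \<sigma> assms(2,3)] unfolding O' by (simp flip: of_nat_sum)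
  ultimately show "1 / real (card O') * (\<Sum>\<pi>\<in>O'. real (ell i \<pi>)) = 1" by simp
qed

end
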